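(* For every positive integer $n$, $$R(P;n)\le 2n+\sqrt{18n+1}+2 .$$
   Context: $P$ denotes the $3$-uniform (loose) path of length three, i.e. the unique (up to isomorphism) connected $3$-uniform hypergraph on seven vertices with degree sequence $(2,2,1,1,1,1,1)$. Explicitly, $P$ has vertices $x_1,\dots,x_7$ and hyperedges $\{x_1,x_2,x_3\}$, $\{x_3,x_4,x_5\}$, $\{x_5,x_6,x_7\}$. $K_N^{(3)}$ denotes the complete $3$-uniform hypergraph on $N$ vertices. $R(P;n)$ denotes the smallest positive integer $N$ such that each coloring of the hyperedges of $K_N^{(3)}$ with $n$ colors contains a monochromatic copy of $P$. A copy of $P$ means a not necessarily induced subhypergraph isomorphic to $P$; it is monochromatic if all its hyperedges have the same color. *)

theory Defs
  imports Complex_Main "HOL-Library.Ramsey"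
begin

text \<open>A hypergraph is a pair of its vertex set and its set of hyperedges.\<close>

type_synonym 'a hypergraph = "'a set \<times> 'a set set"

text \<open>The loose path of length three, on the vertices 1, ..., 7.\<close>

definition loose_path3 :: "nat hypergraph" where
  "loose_path3 = ({1..7}, {{1,2,3}, {3,4,5}, {5,6,7}})"

definition complete3 :: "nat \<Rightarrow> nat hypergraph" where
  "complete3 N = ({..<N}, nsets {..<N} 3)"

definition isomorphic :: "'a hypergraph \<Rightarrow> 'b hypergraph \<Rightarrow> bool" where
  "isomorphic H K \<longleftrightarrow> (\<exists>f. bij_betw f (fst H) (fst K) \<and> snd K = (\<lambda>e. f ` e) ` snd H)"

definition subhypergraph :: "'a hypergraph \<Rightarrow> 'a hypergraph \<Rightarrow> bool" where
  "subhypergraph H G \<longleftrightarrow> fst H \<subseteq> fst G \<and> snd H \<subseteq> snd G \<and> (\<forall>e\<in>snd H. e \<subseteq> fst H)"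

definition monochromatic_copy :: "('a set \<Rightarrow> 'c) \<Rightarrow> 'b hypergraph \<Rightarrow> 'a hypergraph \<Rightarrow> bool" where
  "monochromatic_copy c H G \<longleftrightarrow>
     (\<exists>K k. subhypergraph K G \<and> isomorphic H K \<and> (\<forall>e\<in>snd K. c e = k))"

definition arrows :: "nat \<Rightarrow> 'b hypergraph \<Rightarrow> nat \<Rightarrow> bool" where
  "arrows N H n \<longleftrightarrow>
     (\<forall>c \<in> snd (complete3 N) \<rightarrow> {..<n}. monochromatic_copy c H (complete3 N))"

text \<open>
  The minimum is over a nonempty set, by Ramsey's theorem, for every finite 3-uniform hypergraph;
  for the loose path this is lemma \<open>arrows_loose_path3\<close> below.
\<close>

definition ramsey_number :: "'b hypergraph \<Rightarrow> nat \<Rightarrow> nat" where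
  "ramsey_number H n = (LEAST N. 0 < N \<and> arrows N H n)"

lemma arrows_loose_path3: "\<exists>N>0. arrows N loose_path3 n"
proof -
  obtain N :: nat where N: "partn_lst {..<N} (replicate n 7) 3"
    using ramsey_full by blast
  have "partn_lst {..<Suc N} (replicate n 7) 3"
    using N by (rule partn_lst_greater_resource) simp
  moreover have "monochromatic_copy c loose_path3 (complete3 (Suc N))"
    if H: "H \<in> nsets {..<Suc N} 7" and mono: "c ` nsets H 3 \<subseteq> {i}"
    for c :: "nat set \<Rightarrow> nat" and H i
  proof -
    have "finite H" "card H = 7" "H \<subseteq> {..<Suc N}"
      using H by (auto simp: nsets_def)
    then obtain f where f: "bij_betw f {1..7::nat} H"
      using finite_same_card_bij[of "{1..7::nat}" H] by auto
    define K where "K = (H, (\<lambda>e. f ` e) ` snd loose_path3)"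
    have sub: "snd loose_path3 \<subseteq> nsets {1..7} 3"
      by (simp add: loose_path3_def nsets_def)
    have "f ` e \<in> nsets H 3" if "e \<in> nsets {1..7} 3" for e
      using that f bij_betw_nsets[of f "{1..7}" H 3] bij_betwE by blast
    then have edges: "snd K \<subseteq> nsets H 3"
      using sub by (auto simp: K_def)
    have "subhypergraph K (complete3 (Suc N))"
      using edges \<open>H \<subseteq> {..<Suc N}\<close>
      unfolding subhypergraph_def complete3_def K_def nsets_def
      by (simp only: fst_conv snd_conv) blast
    moreover have "isomorphic loose_path3 K"
      using f unfolding isomorphic_def K_def loose_path3_def by (intro exI[of _ f]) simp
    moreover have "\<forall>e\<in>snd K. c e = i"
      using edges mono by blast
    ultimately show ?thesis
      unfolding monochromatic_copy_def by blast
  qed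
  ultimately have "arrows (Suc N) loose_path3 n"
    unfolding arrows_def partn_lst_def monochromatic_def complete3_def snd_conv length_replicate
    by (metis nth_replicate)
  then show ?thesis by blast
qed

end

theory Submission
  imports Defs
begin

text \<open>
  Let a colour class be free of the loose path and let the codegree of a pair be the number of
  edges of that class containing it. Pairs of codegree at least 5 contain no graph path with three
  edges (such a path extends greedily to a loose path), so there are at most \<open>N\<close> of them; this is
  attained up to one by a full star. Pairs of codegree at least 3 form a 5-degenerate graph, so there
  are at most \<open>5 N\<close> of them.

  Write \<open>N = 2 n + 1 + s\<close>. The codegrees of a fixed pair over all \<open>n\<close> colours add up to
  \<open>N - 2 = 2 n + (s - 1)\<close>, so if the pair has codegree at most 4 in every colour, its excesses over 2
  add up to at least \<open>s - 1\<close>. Hence, giving a pair weight 1 in a colour where its codegree is at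
  least 5 and weight (excess over 2) / \<open>(s - 1)\<close> otherwise, every pair gets total weight at
  least 1, while every colour distributes at most \<open>N (1 + 8 / (s - 1))\<close>. Comparing with the number
  of pairs gives \<open>s (s - 1) \<le> 16 n\<close>, which fails when \<open>s > sqrt (18 n + 1)\<close>.
\<close>

section \<open>Edge counts in graphs, and intersecting families of pairs\<close>

lemma ex_in_diff_of_card_less:
  assumes "finite B" "card B < card A"
  obtains x where "x \<in> A" "x \<notin> B"
  using assms by (metis card_mono not_less subsetI)

text \<open>Repeatedly deleting a vertex of degree at most \<open>k\<close> in what remains destroys
  at most \<open>k\<close> edges each time.\<close>

lemma card_edges_le_of_degenerate:
  fixes k :: nat
  assumes "finite W" "E \<subseteq> nsets W 2"
    and "\<And>U. \<lbrakk>U \<subseteq> W; U \<noteq> {}\<rbrakk> \<Longrightarrow> \<exists>b\<in>U. card {u \<in> U. {b, u} \<in> E} \<le> k"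
  shows "card E \<le> k * card W"
  using assms
proof (induction W arbitrary: E rule: finite_psubset_induct)
  case (psubset W)
  show ?case
  proof (cases "W = {}")
    case True
    then show ?thesis using psubset.prems(1) by (simp add: nsets_eq_empty)
  next
    case False
    then obtain b where b: "b \<in> W" "card {u \<in> W. {b, u} \<in> E} \<le> k"
      using psubset.prems(2)[of W] by auto
    define E' where "E' = {p \<in> E. b \<notin> p}"
    have finE: "finite E"
      using finite_subset[OF psubset.prems(1) finite_imp_finite_nsets[OF psubset.hyps(1)]] .
    have "card E' \<le> k * card (W - {b})"
    proof (rule psubset.IH)
      show "W - {b} \<subset> W" using b by auto
      show "E' \<subseteq> nsets (W - {b}) 2"
        using psubset.prems(1) by (auto simp: E'_def nsets_def)
      show "\<exists>c\<in>U. card {u \<in> U. {c, u} \<in> E'} \<le> k" if U: "U \<subseteq> W - {b}" "U \<noteq> {}" for U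
      proof -
        have "U \<subseteq> W" using U(1) by blast
        then obtain c where c: "c \<in> U" "card {u \<in> U. {c, u} \<in> E} \<le> k"
          using psubset.prems(2)[OF _ U(2)] by blast
        have "finite U" using \<open>U \<subseteq> W\<close> psubset.hyps(1) by (rule finite_subset)
        then have "card {u \<in> U. {c, u} \<in> E'} \<le> card {u \<in> U. {c, u} \<in> E}"
          by (intro card_mono) (auto simp: E'_def)
        then show ?thesis using c by (intro bexI[of _ c]) auto
      qed
    qed
    moreover have "card {p \<in> E. b \<in> p} \<le> k"
    proof -
      have "{p \<in> E. b \<in> p} \<subseteq> (\<lambda>u. {b, u}) ` {u \<in> W. {b, u} \<in> E}"
      proof
        fix p assume p: "p \<in> {p \<in> E. b \<in> p}"
        then have "p \<subseteq> W" "card p = 2" using psubset.prems(1) by (auto simp: nsets_def)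
        then obtain u where "p = {b, u}" using p by (auto simp: card_2_iff)
        then show "p \<in> (\<lambda>u. {b, u}) ` {u \<in> W. {b, u} \<in> E}" using p \<open>p \<subseteq> W\<close> by auto
      qed
      then have "card {p \<in> E. b \<in> p} \<le> card {u \<in> W. {b, u} \<in> E}"
        by (rule surj_card_le[rotated]) (use psubset.hyps in simp)
      then show ?thesis using b(2) by linarith
    qed
    moreover have "card E = card E' + card {p \<in> E. b \<in> p}"
    proof -
      have "E = E' \<union> {p \<in> E. b \<in> p}" by (auto simp: E'_def)
      moreover have "E' \<inter> {p \<in> E. b \<in> p} = {}" by (auto simp: E'_def)
      ultimately show ?thesis using finE
        using card_Un_disjoint[of E' "{p \<in> E. b \<in> p}"] finite_subset[of _ E] by (simp add: E'_def)
    qed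
    moreover have "card W = Suc (card (W - {b}))"
      using card_Suc_Diff1[OF psubset.hyps(1) b(1)] by simp
    ultimately show ?thesis by simp
  qed
qed

text \<open>Let every vertex \<open>u\<close> give \<open>1 / deg u\<close> to each edge at it. A
  vertex gives out at most 1 in total, and without such a path every edge receives at least
  1.\<close>

lemma card_edges_le_if_no_path3:
  assumes "finite W" "E \<subseteq> nsets W 2"
    and no_path: "\<And>a b c d. \<lbrakk>distinct [a, b, c, d]; {a, b} \<in> E; {b, c} \<in> E; {c, d} \<in> E\<rbrakk> \<Longrightarrow> False"
  shows "card E \<le> card W"
proof -
  define deg where "deg u = card {p \<in> E. u \<in> p}" for u
  have finE: "finite E"
    using finite_subset[OF assms(2) finite_imp_finite_nsets[OF assms(1)]] .
  have edgeE: "\<exists>v. p = {u, v} \<and> u \<noteq> v" if "p \<in> E" "u \<in> p" for p u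
  proof -
    have "card p = 2" using that(1) assms(2) by (auto simp: nsets_def)
    then show ?thesis using that(2) by (auto simp: card_2_iff)
  qed
  have ex_other: "\<exists>w. {u, w} \<in> E \<and> w \<notin> X \<and> w \<noteq> u" if X: "card X < deg u" "finite X" for u X
  proof -
    have "card ((\<lambda>x. {u, x}) ` X) < card {p \<in> E. u \<in> p}"
      using card_image_le[OF X(2), of "\<lambda>x. {u, x}"] X(1) by (simp add: deg_def)
    then obtain p where p: "p \<in> {p \<in> E. u \<in> p}" "p \<notin> (\<lambda>x. {u, x}) ` X"
      by (rule ex_in_diff_of_card_less[OF finite_imageI[OF X(2)]])
    then show ?thesis using edgeE[of p u] by auto
  qed
  \<comment> \<open>The choice of \<open>w\<close> next to \<open>v\<close> excludes one vertex and
    that of \<open>x\<close> next to \<open>u\<close> excludes two, whence the thresholds 2 and 3;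
    then \<open>x\<close>, \<open>u\<close>, \<open>v\<close>, \<open>w\<close> is a path.\<close>
  have not32: False if uv: "{u, v} \<in> E" "u \<noteq> v" "3 \<le> deg u" "2 \<le> deg v" for u v
  proof -
    obtain w where w: "{v, w} \<in> E" "w \<noteq> u" "w \<noteq> v"
      using ex_other[of "{u}" v] uv by auto
    have "card {v, w} < deg u" using uv w by simp
    then obtain x where "{u, x} \<in> E" "x \<noteq> v" "x \<noteq> w" "x \<noteq> u"
      using ex_other[of "{v, w}" u] by auto
    then show False using no_path[of x u v w] w uv by (auto simp: insert_commute)
  qed
  \<comment> \<open>every component is a star or a triangle, which makes this weight at least 1\<close>
  have one: "1 \<le> (\<Sum>u\<in>p. 1 / real (deg u))" if p: "p \<in> E" for p
  proof -
    obtain u v where uv: "p = {u, v}" "u \<noteq> v"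
      using p assms(2) by (auto simp: nsets_def card_2_iff)
    have pos: "deg u > 0" "deg v > 0"
      using p uv finE by (auto simp: deg_def card_gt_0_iff)
    have "\<not> (3 \<le> deg u \<and> 2 \<le> deg v)" "\<not> (3 \<le> deg v \<and> 2 \<le> deg u)"
      using not32[of u v] not32[of v u] p uv by (auto simp: insert_commute)
    then have "deg u = 1 \<or> deg v = 1 \<or> (deg u = 2 \<and> deg v = 2)"
      using pos by linarith
    then show ?thesis using uv pos by auto
  qed
  have "real (card E) \<le> (\<Sum>p\<in>E. \<Sum>u\<in>p. 1 / real (deg u))"
    using sum_mono[of E "\<lambda>_. 1::real"] one by simp
  also have "\<dots> = (\<Sum>p\<in>E. \<Sum>u | u \<in> W \<and> u \<in> p. 1 / real (deg u))"
    using assms(2) by (intro sum.cong) (auto simp: nsets_def)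
  also have "\<dots> = (\<Sum>u\<in>W. \<Sum>p | p \<in> E \<and> u \<in> p. 1 / real (deg u))"
    using finE assms(1) by (rule sum.swap_restrict)
  also have "\<dots> \<le> (\<Sum>u\<in>W. 1)"
    by (intro sum_mono) (auto simp: deg_def)
  finally show ?thesis by simp
qed

text \<open>A pairwise intersecting family of pairs is a star or a triangle, and a triangle covers
  only three vertices.\<close>

lemma ex_common_vertex_if_intersecting:
  assumes card2: "\<And>e. e \<in> F \<Longrightarrow> card e = 2"
    and inter: "\<And>e f. \<lbrakk>e \<in> F; f \<in> F\<rbrakk> \<Longrightarrow> e \<inter> f \<noteq> {}"
    and A: "A \<subseteq> \<Union>F" "4 \<le> card A"
  shows "\<exists>z. \<forall>e\<in>F. z \<in> e"
proof -
  have edgeE: "\<exists>v. e = {u, v} \<and> u \<noteq> v" if "e \<in> F" "u \<in> e" for e u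
    using card2[OF that(1)] that(2) by (auto simp: card_2_iff)
  obtain e where e: "e \<in> F" using A by fastforce
  obtain a1 where a1: "a1 \<in> A" "a1 \<notin> e"
    using ex_in_diff_of_card_less[of e A] card2[OF e] A(2) by (metis card.infinite
      less_le_trans numeral_less_iff semiring_norm(76) semiring_norm(78) zero_neq_numeral)
  then obtain e1 where e1: "e1 \<in> F" "a1 \<in> e1" using A by blast
  then obtain z where z: "e1 = {a1, z}" "a1 \<noteq> z" using edgeE by blast
  then have "z \<in> e" using inter[OF e e1(1)] a1 by auto
  then obtain w where w: "e = {z, w}" "z \<noteq> w" using edgeE e by blast
  have "card {z, w, a1} < card A"
    using A(2) by (auto simp: card_insert_if)
  then obtain a2 where a2: "a2 \<in> A" "a2 \<notin> {z, w, a1}"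
    using ex_in_diff_of_card_less[of "{z, w, a1}" A] by auto
  then obtain e2 where e2: "e2 \<in> F" "a2 \<in> e2" using A by blast
  then obtain x where "e2 = {a2, x}" using edgeE by blast
  then have "e2 = {a2, z}"
    using inter[OF e2(1) e] inter[OF e2(1) e1(1)] a2 a1 w z by auto
  \<comment> \<open>The edges \<open>e\<close>, \<open>e1\<close>, \<open>e2\<close> share
    \<open>z\<close> and have three different other ends, too many for a pair avoiding
    \<open>z\<close> to meet them all.\<close>
  then have "z \<in> f" if "f \<in> F" for f
    using inter[OF that e] inter[OF that e1(1)] inter[OF that e2(1)] card2[OF that] a1 a2 w z
    by (auto simp: card_2_iff)
  then show ?thesis by blast
qed

section \<open>Codegrees in one colour class\<close>

locale loose_path_free =
  fixes V :: "'a set" and H :: "'a set set"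
  assumes finite_V: "finite V"
    and edges: "H \<subseteq> nsets V 3"
    and no_path: "\<lbrakk>distinct [x1, x2, x3, x4, x5, x6, x7];
      {x1, x2, x3} \<in> H; {x3, x4, x5} \<in> H; {x5, x6, x7} \<in> H\<rbrakk> \<Longrightarrow> False"
begin

text \<open>For a pair \<open>p\<close>, \<open>card (nb p)\<close> is the codegree of
  \<open>p\<close>.\<close>

definition nb :: "'a set \<Rightarrow> 'a set" where
  "nb p = {x. x \<notin> p \<and> insert x p \<in> H}"

lemma edgeD:
  assumes "{a, b, c} \<in> H"
  shows "a \<noteq> b" "a \<noteq> c" "b \<noteq> c" "a \<in> V" "b \<in> V" "c \<in> V"
proof -
  have "card {a, b, c} = 3" "{a, b, c} \<subseteq> V" using assms edges by (auto simp: nsets_def)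
  then show "a \<noteq> b" "a \<noteq> c" "b \<noteq> c" "a \<in> V" "b \<in> V" "c \<in> V"
    by (auto simp: card_insert_if split: if_splits)
qed

lemma in_nb_iff: "x \<in> nb {a, b} \<longleftrightarrow> {a, b, x} \<in> H"
  using edgeD[of a b x] by (auto simp: nb_def insert_commute)

text \<open>The pairs are completed in turn by \<open>x\<close>, \<open>y\<close>, \<open>z\<close>
  to a loose path. The last choice has to avoid the four vertices \<open>a\<close>,
  \<open>b\<close>, \<open>x\<close>, \<open>y\<close>, which explains the 5.\<close>

lemma no_heavy_path:
  assumes "distinct [a, b, c, d]"
    and "5 \<le> card (nb {a, b})" "5 \<le> card (nb {b, c})" "5 \<le> card (nb {c, d})"
  shows False
proof -
  obtain x where x: "x \<in> nb {a, b}" "x \<notin> {c, d}"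
    using ex_in_diff_of_card_less[of "{c, d}" "nb {a, b}"] assms by (auto simp: card_insert_if)
  have "card {a, d, x} < card (nb {b, c})" using assms by (auto simp: card_insert_if)
  then obtain y where y: "y \<in> nb {b, c}" "y \<notin> {a, d, x}"
    using ex_in_diff_of_card_less[of "{a, d, x}" "nb {b, c}"] by auto
  have "card {a, b, x, y} < card (nb {c, d})" using assms by (auto simp: card_insert_if)
  then obtain z where z: "z \<in> nb {c, d}" "z \<notin> {a, b, x, y}"
    using ex_in_diff_of_card_less[of "{a, b, x, y}" "nb {c, d}"] by auto
  note H = x(1)[unfolded in_nb_iff] y(1)[unfolded in_nb_iff] z(1)[unfolded in_nb_iff]
  show False
    using no_path[of x a b y c d z] H x y z assms edgeD[OF H(1)] edgeD[OF H(2)] edgeD[OF H(3)]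
    by (auto simp: insert_commute)
qed

lemma card_heavy_le: "card {p \<in> nsets V 2. 5 \<le> card (nb p)} \<le> card V"
  by (rule card_edges_le_if_no_path3) (use finite_V no_heavy_path in auto)

section \<open>Degeneracy of the graph of pairs of codegree at least 3\<close>

text \<open>If the pairs were disjoint, \<open>{a, x, b}\<close>, \<open>{b, y, c}\<close>,
  \<open>{c, d, z}\<close> would form a loose path. So outside \<open>{b, c, y}\<close>, each link
  edge of \<open>b\<close> meets each link edge of \<open>c\<close>.\<close>

lemma links_cross_intersecting:
  assumes "{b, c, y} \<in> H" "{b, a, x} \<in> H" "{c, d, z} \<in> H"
    and "a \<notin> {c, y}" "x \<notin> {c, y}" "d \<notin> {b, y}" "z \<notin> {b, y}"
  shows "{a, x} \<inter> {d, z} \<noteq> {}"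
proof
  assume "{a, x} \<inter> {d, z} = {}"
  then show False
    using no_path[of a x b y c d z] assms edgeD[OF assms(1)] edgeD[OF assms(2)] edgeD[OF assms(3)]
    by (auto simp: insert_commute)
qed

text \<open>The assumptions on \<open>W\<close> below are contradictory once \<open>W\<close> is nonempty; this is the
  5-degeneracy.\<close>

context
  fixes W :: "'a set" and G :: "'a \<Rightarrow> 'a set"
  assumes finite_W: "finite W"
  defines "G \<equiv> \<lambda>b. {u \<in> W. 3 \<le> card (nb {b, u})}"
  assumes degree_ge: "\<And>b. b \<in> W \<Longrightarrow> 6 \<le> card (G b)"
begin

lemma card_G_diff:
  assumes "b \<in> W"
  shows "4 \<le> card (G b - {c, y})"
proof -
  have "finite (G b)" using finite_W by (simp add: G_def)
  moreover have "card {c, y} \<le> 2" by (simp add: card_insert_if)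
  ultimately show ?thesis using degree_ge[OF assms] diff_card_le_card_Diff[of "{c, y}" "G b"]
    by simp
qed

lemma ex_edge:
  assumes "a \<in> G b"
  obtains x where "{b, a, x} \<in> H" "x \<notin> {c, y}"
proof -
  have "card {c, y} < card (nb {b, a})" using assms by (auto simp: G_def card_insert_if)
  then show thesis
    using ex_in_diff_of_card_less[of "{c, y}" "nb {b, a}"] that by (auto simp: in_nb_iff)
qed

text \<open>At least four neighbours of \<open>b\<close> remain outside \<open>{c, y}\<close>, so if
  there are only four candidates, all of them occur.\<close>

lemma G_diff_eq:
  assumes "b \<in> W" "distinct [v1, v2, v3, v4]" "G b - {c, y} \<subseteq> {v1, v2, v3, v4}"
  shows "G b - {c, y} = {v1, v2, v3, v4}"
  using card_G_diff[OF assms(1), of c y] assms(2,3) by (intro card_seteq) auto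

lemma nb_eq:
  assumes "a \<in> G b" "nb {b, a} \<subseteq> {u, v, w}"
  shows "nb {b, a} = {u, v, w}"
proof (rule card_seteq)
  have "card {u, v, w} \<le> 3" by (simp add: card_insert_if)
  then show "card {u, v, w} \<le> card (nb {b, a})" using assms by (auto simp: G_def)
qed (use assms in auto)

text \<open>The crossing condition confines the neighbours of \<open>b\<close> and of
  \<open>c\<close> to \<open>v1\<close>, ..., \<open>v4\<close>. Codegree at least 3 then forces the
  further link edges \<open>{v1, v4}\<close> of \<open>b\<close> and \<open>{v2, v3}\<close> of
  \<open>c\<close>, which are disjoint.\<close>

lemma no_crossing_matchings:
  assumes W: "b \<in> W" "c \<in> W" and dist: "distinct [b, c, y, v1, v2, v3, v4]"
    and bcy: "{b, c, y} \<in> H"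
    and b: "{b, v1, v2} \<in> H" "{b, v3, v4} \<in> H"
    and c: "{c, v1, v3} \<in> H" "{c, v2, v4} \<in> H"
  shows False
proof -
  have cbd: "{c, b, y} \<in> H" using bcy by (simp add: insert_commute)
  have hitb: "{a, x} \<inter> {v1, v3} \<noteq> {} \<and> {a, x} \<inter> {v2, v4} \<noteq> {}"
    if "{b, a, x} \<in> H" "a \<notin> {c, y}" "x \<notin> {c, y}" for a x
    using links_cross_intersecting[OF bcy that(1) c(1)]
      links_cross_intersecting[OF bcy that(1) c(2)] that dist by auto
  have hitc: "{a, x} \<inter> {v1, v2} \<noteq> {} \<and> {a, x} \<inter> {v3, v4} \<noteq> {}"
    if "{c, a, x} \<in> H" "a \<notin> {b, y}" "x \<notin> {b, y}" for a x
    using links_cross_intersecting[OF cbd that(1) b(1)]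
      links_cross_intersecting[OF cbd that(1) b(2)] that dist by auto
  have "G b - {c, y} \<subseteq> {v1, v2, v3, v4}"
  proof
    fix a assume a: "a \<in> G b - {c, y}"
    then obtain x where "{b, a, x} \<in> H" "x \<notin> {c, y}" by (blast elim: ex_edge)
    then show "a \<in> {v1, v2, v3, v4}" using hitb[of a x] a dist by auto
  qed
  then have v1: "v1 \<in> G b" using G_diff_eq[OF W(1), of v1 v2 v3 v4 c y] dist by auto
  have "G c - {b, y} \<subseteq> {v1, v2, v3, v4}"
  proof
    fix a assume a: "a \<in> G c - {b, y}"
    then obtain x where "{c, a, x} \<in> H" "x \<notin> {b, y}" by (blast elim: ex_edge)
    then show "a \<in> {v1, v2, v3, v4}" using hitc[of a x] a dist by auto
  qed
  then have v2: "v2 \<in> G c" using G_diff_eq[OF W(2), of v1 v2 v3 v4 b y] dist by auto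
  \<comment> \<open>Otherwise \<open>{v1, y, b}\<close>, \<open>{b, v3, v4}\<close>,
    \<open>{v4, v2, c}\<close> is a loose path; the exclusion of \<open>{c, v2, y}\<close> below is
    the mirror image.\<close>
  have "{b, v1, y} \<notin> H"
    using no_path[of v1 y b v3 v4 v2 c] b c dist by (auto simp: insert_commute)
  then have "x \<in> {c, v2, v4}" if "x \<in> nb {b, v1}" for x
    using that hitb[of v1 x] dist by (auto simp: in_nb_iff)
  then have "nb {b, v1} \<subseteq> {c, v2, v4}" by blast
  then have bv: "{b, v1, v4} \<in> H" using nb_eq[OF v1, of c v2 v4] by (auto simp: in_nb_iff[symmetric])
  have "{c, v2, y} \<notin> H"
    using no_path[of v2 y c v1 v3 v4 b] b c dist by (auto simp: insert_commute)
  then have "x \<in> {b, v3, v4}" if "x \<in> nb {c, v2}" for x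
    using that hitc[of v2 x] dist by (auto simp: in_nb_iff)
  then have "nb {c, v2} \<subseteq> {b, v3, v4}" by blast
  then have "{c, v2, v3} \<in> H" using nb_eq[OF v2, of b v3 v4] by (auto simp: in_nb_iff[symmetric])
  then show False using links_cross_intersecting[OF bcy bv, of v2 v3] dist by auto
qed

text \<open>Outside \<open>{b, y}\<close>, each link edge of \<open>c\<close> joins
  \<open>{v1, v2}\<close> to \<open>{v3, v4}\<close>, and these edges cover all four vertices. They
  therefore contain a perfect matching, the configuration just excluded.\<close>

lemma no_disjoint_link_edges:
  assumes W: "b \<in> W" "c \<in> W" and dist: "distinct [b, c, y, v1, v2, v3, v4]"
    and bcy: "{b, c, y} \<in> H"
    and b: "{b, v1, v2} \<in> H" "{b, v3, v4} \<in> H"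
  shows False
proof -
  have cbd: "{c, b, y} \<in> H" using bcy by (simp add: insert_commute)
  have hitc: "{a, x} \<inter> {v1, v2} \<noteq> {} \<and> {a, x} \<inter> {v3, v4} \<noteq> {}"
    if "{c, a, x} \<in> H" "a \<notin> {b, y}" "x \<notin> {b, y}" for a x
    using links_cross_intersecting[OF cbd that(1) b(1)]
      links_cross_intersecting[OF cbd that(1) b(2)] that dist by auto
  have "G c - {b, y} \<subseteq> {v1, v2, v3, v4}"
  proof
    fix a assume a: "a \<in> G c - {b, y}"
    then obtain x where "{c, a, x} \<in> H" "x \<notin> {b, y}" by (blast elim: ex_edge)
    then show "a \<in> {v1, v2, v3, v4}" using hitc[of a x] a dist by auto
  qed
  then have G: "{v1, v2, v3, v4} \<subseteq> G c"
    using G_diff_eq[OF W(2), of v1 v2 v3 v4 b y] dist by auto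
  have ex: "\<exists>x. {c, a, x} \<in> H \<and> x \<notin> {b, y}" if "a \<in> {v1, v2, v3, v4}" for a
    using that G ex_edge[of a c b y] by blast
  have 1: "{c, v1, v3} \<in> H \<or> {c, v1, v4} \<in> H"
  proof -
    obtain x where "{c, v1, x} \<in> H" "x \<notin> {b, y}" using ex[of v1] by blast
    then show ?thesis using hitc[of v1 x] dist by auto
  qed
  have 2: "{c, v2, v3} \<in> H \<or> {c, v2, v4} \<in> H"
  proof -
    obtain x where "{c, v2, x} \<in> H" "x \<notin> {b, y}" using ex[of v2] by blast
    then show ?thesis using hitc[of v2 x] dist by auto
  qed
  have 3: "{c, v1, v3} \<in> H \<or> {c, v2, v3} \<in> H"
  proof -
    obtain x where "{c, v3, x} \<in> H" "x \<notin> {b, y}" using ex[of v3] by blast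
    then show ?thesis using hitc[of v3 x] dist by (auto simp: insert_commute)
  qed
  have 4: "{c, v1, v4} \<in> H \<or> {c, v2, v4} \<in> H"
  proof -
    obtain x where "{c, v4, x} \<in> H" "x \<notin> {b, y}" using ex[of v4] by blast
    then show ?thesis using hitc[of v4 x] dist by (auto simp: insert_commute)
  qed
  \<comment> \<open>Lacking an edge of each of the two matchings would isolate the vertex these
    edges share. Swapping \<open>v3\<close> and \<open>v4\<close> exchanges the matchings.\<close>
  from 1 2 3 4 have "{c, v1, v3} \<in> H \<and> {c, v2, v4} \<in> H \<or> {c, v1, v4} \<in> H \<and> {c, v2, v3} \<in> H"
    by blast
  moreover have "{b, v4, v3} \<in> H" using b(2) by (simp add: insert_commute)
  ultimately show False
    using no_crossing_matchings[OF W _ bcy b] no_crossing_matchings[OF W _ bcy b(1), of v4 v3] dist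
    by auto
qed

text \<open>For an edge \<open>{b, c, y}\<close>, the link \<open>F\<close> of \<open>b\<close>
  outside \<open>{c, y}\<close> is intersecting and covers at least four vertices, so it is a star
  with some centre \<open>z\<close>. This determines the codegree sets of the remaining neighbours
  of \<open>b\<close>.\<close>

lemma no_dense_codegree_graph:
  assumes "b \<in> W"
  shows False
proof -
  have "G b \<noteq> {}" using degree_ge[OF assms] by auto
  then obtain c where c: "c \<in> G b" by blast
  then have cW: "c \<in> W" by (simp add: G_def)
  obtain y where bcy: "{b, c, y} \<in> H" using ex_edge[OF c, of b b] by blast
  define F where "F = {e. \<exists>u v. e = {u, v} \<and> {b, u, v} \<in> H \<and> u \<notin> {c, y} \<and> v \<notin> {c, y}}"
  have "\<exists>z. \<forall>e\<in>F. z \<in> e"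
  proof (rule ex_common_vertex_if_intersecting)
    show "card e = 2" if "e \<in> F" for e
      using that edgeD by (fastforce simp: F_def)
    show "e \<inter> f \<noteq> {}" if ef: "e \<in> F" "f \<in> F" for e f
    proof
      assume disj: "e \<inter> f = {}"
      obtain u v u' v' where e: "e = {u, v}" "{b, u, v} \<in> H" "u \<notin> {c, y}" "v \<notin> {c, y}"
        and f: "f = {u', v'}" "{b, u', v'} \<in> H" "u' \<notin> {c, y}" "v' \<notin> {c, y}"
        using ef unfolding F_def by blast
      show False
        using no_disjoint_link_edges[OF assms cW _ bcy e(2) f(2)] e f disj
          edgeD[OF bcy] edgeD[OF e(2)] edgeD[OF f(2)] by auto
    qed
    show "4 \<le> card (G b - {c, y})" using card_G_diff[OF assms] .
    show "G b - {c, y} \<subseteq> \<Union>F"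
    proof
      fix a assume a: "a \<in> G b - {c, y}"
      then obtain x where "{b, a, x} \<in> H" "x \<notin> {c, y}" by (blast elim: ex_edge)
      then have "{a, x} \<in> F" using a by (auto simp: F_def)
      then show "a \<in> \<Union>F" by blast
    qed
  qed
  \<comment> \<open>\<open>y\<close> was arbitrary; the star structure yields an edge \<open>{b, c, a1}\<close> that, in place of
    \<open>{b, c, y}\<close>, leaves disjoint pairs in the link of \<open>b\<close>\<close>
  then obtain z where z: "\<And>e. e \<in> F \<Longrightarrow> z \<in> e" by blast
  have nb: "nb {b, a} = {c, y, z}" if a: "a \<in> G b - {c, y}" "a \<noteq> z" for a
  proof (rule nb_eq)
    show "nb {b, a} \<subseteq> {c, y, z}"
    proof
      fix x assume "x \<in> nb {b, a}"
      then have "x \<notin> {c, y} \<Longrightarrow> {a, x} \<in> F" using a by (auto simp: F_def in_nb_iff)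
      then show "x \<in> {c, y, z}" using z a by fastforce
    qed
  qed (use a in simp)
  have "card (G b - {c, y} - {z}) \<ge> 3"
    using card_G_diff[OF assms, of c y] diff_card_le_card_Diff[of "{z}" "G b - {c, y}"] by simp
  then obtain a1 a2 a3 where a: "{a1, a2, a3} \<subseteq> G b - {c, y} - {z}" "distinct [a1, a2, a3]"
    by (auto elim!: obtain_subset_with_card_n simp: card_3_iff)
  then have e: "{b, a1, c} \<in> H" "{b, a2, y} \<in> H" "{b, a3, z} \<in> H"
    using nb by (auto simp: in_nb_iff[symmetric])
  \<comment> \<open>The set \<open>{c, y, z}\<close> is the codegree set of \<open>{b, a3}\<close>
    and so has three elements. Hence the link edges \<open>{a2, y}\<close> and
    \<open>{a3, z}\<close> are disjoint.\<close>
  have "z \<noteq> c \<and> z \<noteq> y"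
  proof -
    have "{a3, z} \<in> F \<or> z \<in> {c, y}" using e a by (auto simp: F_def)
    moreover have "3 \<le> card {c, y, z}" using nb[of a3] a by (auto simp: G_def)
    ultimately show ?thesis by (auto simp: card_insert_if split: if_splits)
  qed
  then show False
    using no_disjoint_link_edges[OF assms cW _ _ e(2,3), of a1] e(1) a
      edgeD[OF bcy] edgeD[OF e(1)] edgeD[OF e(2)] edgeD[OF e(3)]
    by (auto simp: insert_commute)
qed

end

section \<open>Edge and weight bounds for one colour\<close>

lemma card_codegree_ge_3_le: "card {p \<in> nsets V 2. 3 \<le> card (nb p)} \<le> 5 * card V"
proof (rule card_edges_le_of_degenerate)
  fix U assume U: "U \<subseteq> V" "U \<noteq> {}"
  then have finU: "finite U" using finite_V finite_subset by blast
  have "\<exists>b\<in>U. card {u \<in> U. 3 \<le> card (nb {b, u})} \<le> 5"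
  proof (rule ccontr)
    assume "\<not> ?thesis"
    then have "6 \<le> card {u \<in> U. 3 \<le> card (nb {b, u})}" if "b \<in> U" for b
      using that by force
    then show False using no_dense_codegree_graph[OF finU] U(2) by blast
  qed
  then obtain b where b: "b \<in> U" "card {u \<in> U. 3 \<le> card (nb {b, u})} \<le> 5" by blast
  have "card {u \<in> U. {b, u} \<in> {p \<in> nsets V 2. 3 \<le> card (nb p)}}
      \<le> card {u \<in> U. 3 \<le> card (nb {b, u})}"
    using finU by (intro card_mono) auto
  then show "\<exists>b\<in>U. card {u \<in> U. {b, u} \<in> {p \<in> nsets V 2. 3 \<le> card (nb p)}} \<le> 5"
    using b by (intro bexI[of _ b]) auto
qed (use finite_V in auto)

text \<open>Codegrees 3 and 4 have excess at most 2, so the weight is at most \<open>2 / r\<close>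
  on \<open>B\<close> plus a further \<open>1 - 2 / r\<close> on \<open>A\<close>. The latter is
  nonnegative as \<open>r\<close> is at least 2, so the bounds on \<open>card A\<close> and
  \<open>card B\<close> apply.\<close>

lemma sum_weight_le:
  fixes r :: real
  assumes "2 \<le> r"
  shows "(\<Sum>p\<in>nsets V 2. if 5 \<le> card (nb p) then 1 else real (card (nb p) - 2) / r)
    \<le> card V * (1 + 8 / r)"
proof -
  define A where "A = {p \<in> nsets V 2. 5 \<le> card (nb p)}"
  define B where "B = {p \<in> nsets V 2. 3 \<le> card (nb p)}"
  have fin: "finite (nsets V 2)" using finite_V by (rule finite_imp_finite_nsets)
  have AB: "A \<subseteq> B" "finite B" using fin by (auto simp: A_def B_def)
  have "(\<Sum>p\<in>nsets V 2. if 5 \<le> card (nb p) then 1 else real (card (nb p) - 2) / r)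
    \<le> (\<Sum>p\<in>nsets V 2. (if p \<in> A then 1 - 2 / r else 0) + (if p \<in> B then 2 / r else 0))"
    using assms by (intro sum_mono) (auto simp: A_def B_def divide_right_mono)
  also have "\<dots> = card A * (1 - 2 / r) + card B * (2 / r)"
    using fin by (simp add: sum.distrib A_def B_def sum.inter_filter[symmetric])
  also have "\<dots> \<le> card V * (1 - 2 / r) + real (5 * card V) * (2 / r)"
    using card_heavy_le card_codegree_ge_3_le assms unfolding A_def[symmetric] B_def[symmetric]
    by (intro add_mono mult_right_mono) (simp_all only: of_nat_le_iff, auto)
  also have "\<dots> = card V * (1 + 8 / r)"
    by (simp add: algebra_simps)
  finally show ?thesis .
qed

end

section \<open>Combining the colour classes\<close>

lemma monochromatic_copy_loose_path3:
  assumes dist: "distinct [x1, x2, x3, x4, x5, x6, x7]"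
    and E: "\<And>e. e \<in> {{x1, x2, x3}, {x3, x4, x5}, {x5, x6, x7}} \<Longrightarrow> e \<in> nsets {..<N} 3 \<and> c e = k"
  shows "monochromatic_copy c loose_path3 (complete3 N)"
proof -
  define f :: "nat \<Rightarrow> nat" where "f i = [x1, x2, x3, x4, x5, x6, x7] ! (i - 1)" for i
  have f: "f 1 = x1" "f 2 = x2" "f 3 = x3" "f 4 = x4" "f 5 = x5" "f 6 = x6" "f 7 = x7"
    by (simp_all add: f_def eval_nat_numeral)
  have I: "{1..7::nat} = {1, 2, 3, 4, 5, 6, 7}" by auto
  define K where "K = ({x1, x2, x3, x4, x5, x6, x7}, {{x1, x2, x3}, {x3, x4, x5}, {x5, x6, x7}})"
  have "isomorphic loose_path3 K"
    unfolding isomorphic_def loose_path3_def K_def fst_conv snd_conv I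
    by (intro exI[of _ f]) (use dist f in \<open>auto simp: bij_betw_def inj_on_def\<close>)
  moreover have "subhypergraph K (complete3 N)"
    using E unfolding subhypergraph_def K_def complete3_def nsets_def by auto
  moreover have "\<forall>e\<in>snd K. c e = k" using E by (simp add: K_def)
  ultimately show ?thesis unfolding monochromatic_copy_def by blast
qed

text \<open>Each vertex \<open>x\<close> of \<open>V - p\<close> is counted exactly once, in the
  colour of \<open>insert x p\<close>.\<close>

lemma sum_card_nb_color_classes:
  assumes "finite V" "p \<in> nsets V 2" "c \<in> nsets V 3 \<rightarrow> {..<n::nat}"
  shows "(\<Sum>i<n. card {x. x \<notin> p \<and> insert x p \<in> {e \<in> nsets V 3. c e = i}}) = card V - 2"
proof -
  have p: "p \<subseteq> V" "card p = 2" "finite p" using assms(2) by (auto simp: nsets_def)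
  define X where "X i = {x. x \<notin> p \<and> insert x p \<in> {e \<in> nsets V 3. c e = i}}" for i
  have "insert x p \<in> nsets V 3" if "x \<in> V - p" for x
    using that p by (auto simp: nsets_def)
  then have "(\<Union>i<n. X i) = V - p"
    using assms(3) by (fastforce simp: X_def nsets_def)
  moreover have "card (\<Union>i<n. X i) = (\<Sum>i<n. card (X i))"
    by (intro card_UN_disjoint)
       (auto simp: X_def nsets_def intro: finite_subset[OF _ assms(1)])
  moreover have "card (V - p) = card V - 2" using p by (simp add: card_Diff_subset)
  ultimately show ?thesis by (simp add: X_def)
qed

lemma arrows_loose_path3_if:
  assumes "n > 0" "N > 2 * n + 1" "16 * n < (N - 2 * n - 1) * (N - 2 * n - 2)"
  shows "arrows N loose_path3 n"
  unfolding arrows_def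
proof (rule ballI, rule ccontr)
  fix c :: "nat set \<Rightarrow> nat"
  assume "c \<in> snd (complete3 N) \<rightarrow> {..<n}"
    and no_copy: "\<not> monochromatic_copy c loose_path3 (complete3 N)"
  then have c: "c \<in> nsets {..<N} 3 \<rightarrow> {..<n}" by (simp add: complete3_def)
  define H where "H i = {e \<in> nsets {..<N} 3. c e = i}" for i
  define d where "d i p = card {x. x \<notin> p \<and> insert x p \<in> H i}" for i and p :: "nat set"
  define s where "s = N - 2 * n - 1"
  define w where "w i p = (if 5 \<le> d i p then 1 else real (d i p - 2) / real (s - 1))" for i p
  have N: "N = 2 * n + 1 + s" using assms by (simp add: s_def)
  have s: "16 * n < s * (s - 1)" using assms by (simp add: s_def)
  \<comment> \<open>This makes \<open>s - 1\<close> large enough to serve as \<open>r\<close> in the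
    weight bound.\<close>
  have "s \<ge> 5"
  proof (rule ccontr)
    assume "\<not> s \<ge> 5"
    then have "s * (s - 1) \<le> 4 * 3" by (intro mult_le_mono) auto
    then show False using s assms(1) by simp
  qed
  have free: "loose_path_free {..<N} (H i)" for i
  proof
    show False if "distinct [x1, x2, x3, x4, x5, x6, x7]"
      "{x1, x2, x3} \<in> H i" "{x3, x4, x5} \<in> H i" "{x5, x6, x7} \<in> H i" for x1 x2 x3 x4 x5 x6 x7
      using monochromatic_copy_loose_path3[OF that(1), of N c i] that(2-4) no_copy
      by (auto simp: H_def)
  qed (auto simp: H_def)
  have d_eq: "d i p = card (loose_path_free.nb (H i) p)" for i p
    by (simp add: d_def loose_path_free.nb_def[OF free])
  have le: "(\<Sum>p\<in>nsets {..<N} 2. w i p) \<le> real N * (1 + 8 / real (s - 1))" for i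
    using loose_path_free.sum_weight_le[OF free[of i], of "real (s - 1)"] \<open>s \<ge> 5\<close>
    by (simp add: w_def d_eq cong: if_cong)
  have ge: "1 \<le> (\<Sum>i<n. w i p)" if p: "p \<in> nsets {..<N} 2" for p
  proof (cases "\<exists>i<n. 5 \<le> d i p")
    case True
    then obtain i where "i < n" "w i p = 1" by (auto simp: w_def)
    moreover have "w j p \<ge> 0" for j by (simp add: w_def)
    ultimately show ?thesis
      using member_le_sum[of i "{..<n}" "\<lambda>j. w j p"] by auto
  next
    case False
    have "N - 2 = (\<Sum>i<n. d i p)"
      using sum_card_nb_color_classes[OF _ p c] by (simp add: d_def H_def)
    \<comment> \<open>Truncated subtraction makes this an inequality: codegrees below 2 count as
      excess 0.\<close>
    also have "\<dots> \<le> (\<Sum>i<n. (d i p - 2) + 2)" by (intro sum_mono) simp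
    also have "\<dots> = (\<Sum>i<n. d i p - 2) + 2 * n" by (simp only: sum.distrib) simp
    finally have "s - 1 \<le> (\<Sum>i<n. d i p - 2)" using N by simp
    then have "real (s - 1) \<le> (\<Sum>i<n. real (d i p - 2))"
      by (simp only: of_nat_sum[symmetric] of_nat_le_iff)
    moreover have "(\<Sum>i<n. w i p) = (\<Sum>i<n. real (d i p - 2)) / real (s - 1)"
      unfolding sum_divide_distrib using False by (intro sum.cong) (auto simp: w_def)
    ultimately show ?thesis using \<open>s \<ge> 5\<close> by simp
  qed
  have "real (N choose 2) = real (card (nsets {..<N} 2))"
    by simp
  also have "\<dots> \<le> (\<Sum>p\<in>nsets {..<N} 2. \<Sum>i<n. w i p)"
    using sum_mono[of "nsets {..<N} 2" "\<lambda>_. 1::real"] ge by simp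
  also have "\<dots> = (\<Sum>i<n. \<Sum>p\<in>nsets {..<N} 2. w i p)" by (rule sum.swap)
  also have "\<dots> \<le> (\<Sum>i<n. real N * (1 + 8 / real (s - 1)))" by (intro sum_mono le)
  finally have "real (N choose 2) \<le> n * (N * (1 + 8 / real (s - 1)))" by simp
  moreover have "real (N choose 2) = real N * (real N - 1) / 2"
    using N by (simp add: choose_two real_of_nat_div algebra_simps)
  ultimately have "real N * ((real N - 1) / 2) \<le> real N * (n * (1 + 8 / real (s - 1)))"
    by (simp only: times_divide_eq_right mult.left_commute)
  then have "(real N - 1) / 2 \<le> n * (1 + 8 / real (s - 1))"
    by (rule mult_left_le_imp_le) (use N in simp)
  \<comment> \<open>Since \<open>(N - 1) / 2\<close> is \<open>n + s / 2\<close>, the terms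
    \<open>n\<close> cancel.\<close>
  then have "real s \<le> 16 * n / real (s - 1)"
    using N by (simp add: algebra_simps)
  then have "real (s * (s - 1)) \<le> real (16 * n)"
    using \<open>s \<ge> 5\<close> by (simp add: pos_le_divide_eq)
  then show False using s by linarith
qed

section \<open>Arithmetic for the explicit bound\<close>

theorem mainTheorem1:
  fixes n :: nat
  assumes "n > 0"
  shows "real (ramsey_number loose_path3 n) \<le> 2 * real n + sqrt (18 * real n + 1) + 2"
proof -
  define r where "r = sqrt (18 * real n + 1)"
  \<comment> \<open>Rounding down costs less than 1, which still leaves \<open>s\<close> strictly
    above \<open>r\<close>.\<close>
  define N where "N = nat \<lfloor>2 * real n + r + 2\<rfloor>"
  define s where "s = N - 2 * n - 1"
  have r: "r \<ge> 0" "r * r = 18 * real n + 1" by (simp_all add: r_def)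
  have N_le: "real N \<le> 2 * real n + r + 2" and N_gt: "2 * real n + r + 1 < real N"
    using r(1) unfolding N_def by linarith+
  have N: "N = 2 * n + 1 + s" using N_gt r(1) by (simp add: s_def)
  then have "r < real s" using N_gt by simp
  then have "r * r < real s * real s" using r(1) by (intro mult_strict_mono') auto
  then have "real (18 * n + 1) < real (s * s)" using r(2) by simp
  then have ss: "18 * n + 1 < s * s" by (simp only: of_nat_less_iff)
  have big: "s \<ge> k" if "(k - 1) * (k - 1) \<le> 18 * n + 1" for k
  proof (rule ccontr)
    assume "\<not> s \<ge> k"
    then have "s * s \<le> (k - 1) * (k - 1)" by (intro mult_le_mono) auto
    then show False using ss that by simp
  qed
  \<comment> \<open>If \<open>s \<le> 2 * n\<close>, subtracting \<open>s\<close> from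
    \<open>s * s > 18 * n + 1\<close> suffices. Otherwise \<open>s - 1 \<ge> 2 * n\<close>, and
    \<open>n \<ge> 4\<close> gives \<open>s \<ge> 9\<close>; smaller \<open>n\<close> are checked
    separately through \<open>big\<close>.\<close>
  have s: "16 * n < s * (s - 1)"
  proof (cases "s \<le> 2 * n")
    case True
    then show ?thesis using ss by (simp add: diff_mult_distrib2)
  next
    case False
    consider "n = 1" | "n = 2" | "n = 3" | "n \<ge> 4" using assms by linarith
    then show ?thesis
    proof cases
      case 1
      then have "s \<ge> 5" using big[of 5] by simp
      then have "5 * 4 \<le> s * (s - 1)" by (intro mult_le_mono) auto
      then show ?thesis using 1 by simp
    next
      case 2
      then have "s \<ge> 7" using big[of 7] by simp
      then have "7 * 6 \<le> s * (s - 1)" by (intro mult_le_mono) auto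
      then show ?thesis using 2 by simp
    next
      case 3
      then have "s \<ge> 8" using big[of 8] by simp
      then have "8 * 7 \<le> s * (s - 1)" by (intro mult_le_mono) auto
      then show ?thesis using 3 by simp
    next
      case 4
      then have "9 * (2 * n) \<le> s * (s - 1)" using False by (intro mult_le_mono) auto
      then show ?thesis using assms by simp
    qed
  qed
  have "arrows N loose_path3 n"
    using assms N s by (intro arrows_loose_path3_if) (auto intro!: Nat.gr0I)
  then have "ramsey_number loose_path3 n \<le> N"
    unfolding ramsey_number_def using N by (intro Least_le) simp
  then show ?thesis using N_le by (simp add: r_def)
qed

end
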